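(* For $d\geq2$ and $k\geq1$, let $A^{[k]}_d$ be the adjacency matrix of the distance-$k$ graph of the $d$-regular tree. Then, for fixed $k$, the distribution with respect to the vacuum state of $d^{-k/2}A^{[k]}_d$ converges in moments as $d\to\infty$ to the distribution of $P_k(s)$, where $s$ is a random variable with the semicircle law.
   Context: The distance-$k$ graph of a graph has the same vertex set, with two vertices adjacent iff their graph distance is exactly $k$. For a fixed vertex $r$ of the tree, the vacuum state is $M\mapsto M_{rr}$, and the distribution of $M$ with respect to it is the probability measure with moments $(M^m)_{rr}$, $m\geq0$. $P_k$ is the Chebyshev polynomial defined by $P_0=1$, $P_1(x)=x$, $xP_n(x)=P_{n+1}(x)+P_{n-1}(x)$; the semicircle law has density $\frac{1}{2\pi}\sqrt{4-x^2}$ on $[-2,2]$. *)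

theory Defs
  imports
    "HOL-Probability.Probability"
    "HOL-Computational_Algebra.Polynomial"
    "Graph_Theory.Pair_Digraph"
    "Graph_Theory.Digraph_Component"
    "Graph_Theory.Shortest_Path"
begin

text \<open>
  Undirected simple graphs, possibly infinite, are symmetric loop-free pair digraphs.
  The predicate \<^const>\<open>Digraph_Component.tree\<close> cannot be used for these: it forbids every directed
  cycle, while each edge of a symmetric digraph yields a directed cycle of length 2, which is
  not a cycle of the undirected graph. In a simple graph, the directed cycles of length at least 3
  are precisely the (oriented) cycles of the undirected graph.
\<close>

definition undirected_tree :: "'a pair_pre_digraph \<Rightarrow> bool" where
  "undirected_tree G \<longleftrightarrow>
     pair_bidirected_digraph G \<and>
     Digraph_Component.connected (with_proj G) \<and>
     \<not> (\<exists>p. pre_digraph.cycle (with_proj G) p \<and> length p \<ge> 3)"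

definition regular_tree :: "nat \<Rightarrow> 'a pair_pre_digraph \<Rightarrow> bool" where
  "regular_tree d G \<longleftrightarrow>
     undirected_tree G \<and>
     (\<forall>v\<in>pverts G. finite (out_arcs (with_proj G) v) \<and> out_degree (with_proj G) v = d)"

definition graph_dist :: "'a pair_pre_digraph \<Rightarrow> 'a \<Rightarrow> 'a \<Rightarrow> ereal" where
  "graph_dist G u v = wf_digraph.\<mu> (with_proj G) (\<lambda>_. 1) u v"

definition distance_graph :: "nat \<Rightarrow> 'a pair_pre_digraph \<Rightarrow> 'a pair_pre_digraph" where
  "distance_graph k G =
     \<lparr> pverts = pverts G,
       parcs = {(u, v). u \<in> pverts G \<and> v \<in> pverts G \<and> graph_dist G u v = ereal (real k)} \<rparr>"

definition adjacency_matrix :: "'a pair_pre_digraph \<Rightarrow> 'a \<Rightarrow> 'a \<Rightarrow> real" where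
  "adjacency_matrix G u v = (if (u, v) \<in> parcs G then 1 else 0)"

text \<open>
  Real matrices with rows and columns indexed by a possibly infinite set \<open>V\<close>. For adjacency
  matrices of locally finite graphs, and their multiples and powers, all sums have only finitely
  many nonzero terms.
\<close>

definition matrix_times :: "'a set \<Rightarrow> ('a \<Rightarrow> 'a \<Rightarrow> real) \<Rightarrow> ('a \<Rightarrow> 'a \<Rightarrow> real) \<Rightarrow> 'a \<Rightarrow> 'a \<Rightarrow> real" where
  "matrix_times V M N u v = (\<Sum>\<^sub>\<infinity>w\<in>V. M u w * N w v)"

primrec matrix_power :: "'a set \<Rightarrow> ('a \<Rightarrow> 'a \<Rightarrow> real) \<Rightarrow> nat \<Rightarrow> 'a \<Rightarrow> 'a \<Rightarrow> real" where
  "matrix_power V M 0 = (\<lambda>u v. if u = v then 1 else 0)"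
| "matrix_power V M (Suc m) = matrix_times V M (matrix_power V M m)"

definition vacuum_state :: "'a \<Rightarrow> ('a \<Rightarrow> 'a \<Rightarrow> real) \<Rightarrow> real" where
  "vacuum_state r M = M r r"

text \<open>The moment sequence of the distribution of \<open>M\<close> with respect to the vacuum state at \<open>r\<close>.\<close>

definition vacuum_moments :: "'a set \<Rightarrow> 'a \<Rightarrow> ('a \<Rightarrow> 'a \<Rightarrow> real) \<Rightarrow> nat \<Rightarrow> real" where
  "vacuum_moments V r M m = vacuum_state r (matrix_power V M m)"

text \<open>
  Convergence in moments of a sequence of distributions, the \<open>n\<close>-th of which has the moment
  sequence \<open>c n\<close>, to a probability measure on the reals all of whose moments are finite.
\<close>

definition converges_in_moments :: "(nat \<Rightarrow> nat \<Rightarrow> real) \<Rightarrow> real measure \<Rightarrow> bool" where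
  "converges_in_moments c \<nu> \<longleftrightarrow>
     (\<forall>m. integrable \<nu> (\<lambda>x. x ^ m) \<and> (\<lambda>n. c n m) \<longlonglongrightarrow> (\<integral>x. x ^ m \<partial>\<nu>))"

fun chebyshev_P :: "nat \<Rightarrow> real poly" where
  "chebyshev_P 0 = 1"
| "chebyshev_P (Suc 0) = [:0, 1:]"
| "chebyshev_P (Suc (Suc n)) = [:0, 1:] * chebyshev_P (Suc n) - chebyshev_P n"

definition semicircle_density :: "real \<Rightarrow> real" where
  "semicircle_density x = (if x \<in> {-2..2} then sqrt (4 - x\<^sup>2) / (2 * pi) else 0)"

end

theory Submission
  imports Defs
begin

text \<open>
  In a tree, every vertex \<open>u \<noteq> v\<close> has exactly one neighbour closer to \<open>v\<close>, and all its other
  neighbours are farther from \<open>v\<close>. Hence the distance-\<open>k\<close> operator \<open>A\<^sub>k\<close> preserves the functions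
  that are radial around the root, and \<open>A\<^sub>1 A\<^sub>k = A\<^sub>k\<^sub>+\<^sub>1 + (d - 1) A\<^sub>k\<^sub>-\<^sub>1\<close> (with \<open>d\<close> in place of
  \<open>d - 1\<close> if \<open>k = 1\<close>). After normalisation, \<open>A\<^sub>1\<close> acts on radial functions by
  \<open>g \<mapsto> (j \<mapsto> g (j - 1) + (1 - 1/d) g (j + 1))\<close>, and as \<open>d \<rightarrow> \<infinity>\<close> both recursions become that
  of the Chebyshev polynomials. For \<open>g j = E[p(s) P\<^sub>j(s)]\<close> the limiting operator is multiplication
  of \<open>p\<close> by \<open>P\<^sub>k\<close>. The root indicator is \<open>E[P\<^sub>j(s)]\<close> by orthogonality of the Chebyshev
  polynomials for the semicircle law, so the \<open>m\<close>-th moment tends to \<open>E[P\<^sub>k(s)\<^sup>m]\<close>.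
\<close>

section \<open>Distances in trees\<close>

locale bidirected_tree = pair_bidirected_digraph G for G :: "'a pair_pre_digraph" +
  assumes connected: "Digraph_Component.connected (with_proj G)"
    and no_long_cycle: "\<And>p. cycle p \<Longrightarrow> length p < 3"
begin

definition nbrs :: "'a \<Rightarrow> 'a set" where
  "nbrs u = {w. (u, w) \<in> parcs G}"

definition hops :: "'a \<Rightarrow> 'a \<Rightarrow> nat" where
  "hops u v = (LEAST n. \<exists>p. awalk u p v \<and> length p = n)"

lemma exists_awalk:
  assumes "u \<in> pverts G" "v \<in> pverts G"
  shows "\<exists>p. awalk u p v"
proof -
  have "strongly_connected (with_proj G)"
    by (rule symmetric_connected_imp_strongly_connected[OF sym_arcs connected])
  then show ?thesis
    using assms by (auto simp: reachable_awalk elim!: strongly_connectedE)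
qed

lemma geodesic:
  assumes "u \<in> pverts G" "v \<in> pverts G"
  obtains p where "awalk u p v" "length p = hops u v"
proof -
  have "\<exists>n p. awalk u p v \<and> length p = n"
    using exists_awalk[OF assms] by blast
  then have "\<exists>p. awalk u p v \<and> length p = hops u v"
    unfolding hops_def by (rule LeastI_ex)
  then show ?thesis using that by blast
qed

lemma hops_le: "awalk u p v \<Longrightarrow> hops u v \<le> length p"
  unfolding hops_def by (rule Least_le) blast

text \<open>The infimum over all walks is attained by a shortest one, which allows induction and
  subtraction on natural-number distances.\<close>

lemma graph_dist_eq_hops:
  assumes "u \<in> pverts G" "v \<in> pverts G"
  shows "graph_dist G u v = ereal (real (hops u v))"
proof -
  have cost: "awalk_cost (\<lambda>_. 1) p = real (length p)" for p :: "('a \<times> 'a) list"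
    by (induct p) auto
  obtain p where p: "awalk u p v" "length p = hops u v"
    using geodesic[OF assms] .
  have "(INF p\<in>{p. awalk u p v}. ereal (awalk_cost (\<lambda>_. 1) p)) = ereal (real (hops u v))"
  proof (rule INF_eqI)
    show "ereal (real (hops u v)) \<le> ereal (awalk_cost (\<lambda>_. 1) q)" if "q \<in> {p. awalk u p v}" for q
      using that by (simp add: cost hops_le)
    show "y \<le> ereal (real (hops u v))"
      if "\<And>q. q \<in> {p. awalk u p v} \<Longrightarrow> y \<le> ereal (awalk_cost (\<lambda>_. 1) q)" for y
      using that[of p] p by (simp add: cost)
  qed
  then show ?thesis
    by (simp add: graph_dist_def \<mu>_def)
qed

lemma hops_eq_0_iff:
  assumes "u \<in> pverts G" "v \<in> pverts G"
  shows "hops u v = 0 \<longleftrightarrow> u = v"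
proof
  obtain p where p: "awalk u p v" "length p = hops u v"
    using geodesic[OF assms] .
  then show "u = v" if "hops u v = 0"
    using that by (auto simp: awalk_Nil_iff)
  show "hops u v = 0" if "u = v"
    using hops_le[of u "[]" v] that assms by (simp add: awalk_Nil_iff)
qed

lemma nbrs_subset: "nbrs u \<subseteq> pverts G"
  by (auto simp: nbrs_def dest: in_arcsD2)

lemma nbrs_sym: "w \<in> nbrs u \<Longrightarrow> u \<in> nbrs w"
  by (auto simp: nbrs_def intro: arcs_symmetric)

lemma nbrs_neq: "w \<in> nbrs u \<Longrightarrow> w \<noteq> u"
  by (auto simp: nbrs_def dest: no_loops')

lemma hops_step:
  assumes "w \<in> nbrs u" "v \<in> pverts G"
  shows "hops u v \<le> Suc (hops w v)"
proof -
  obtain p where "awalk w p v" "length p = hops w v"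
    using geodesic[of w v] nbrs_subset assms by blast
  then show ?thesis
    using hops_le[of u "(u, w) # p" v] assms
    by (auto simp: awalk_Cons_iff nbrs_def)
qed

text \<open>Cutting a geodesic at \<open>x\<close> leaves a final segment to \<open>v\<close> that
  is strictly shorter unless the cut is at the start.\<close>

lemma geodesic_verts:
  assumes "awalk u p v" "length p = hops u v" "x \<in> set (awalk_verts u p)"
  shows "x = u \<or> hops x v < hops u v"
proof -
  obtain q s where qs: "p = q @ s" "awalk u q x" "awalk x s v"
    using awalk_decomp[OF assms(1,3)] by blast
  show ?thesis
  proof (cases q)
    case Nil
    then show ?thesis using qs by (simp add: awalk_Nil_iff)
  next
    case (Cons e es)
    then have "length s < hops u v" using qs assms by simp
    then show ?thesis using hops_le[OF qs(3)] by simp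
  qed
qed

text \<open>A walk avoiding \<open>u\<close> could be shortened to a path from \<open>w\<close> to
  \<open>w'\<close> and closed through \<open>u\<close>. This cycle has length at least 3 because
  \<open>w\<close> and \<open>w'\<close> differ.\<close>

lemma awalk_between_nbrs_visits:
  assumes "w \<in> nbrs u" "w' \<in> nbrs u" "w \<noteq> w'" "awalk w p w'"
  shows "u \<in> set (awalk_verts w p)"
proof (rule ccontr)
  assume u: "u \<notin> set (awalk_verts w p)"
  define q where "q = awalk_to_apath p"
  have q: "awalk w q w'" "distinct (awalk_verts w q)"
    using apath_awalk_to_apath[OF assms(4)] by (auto simp: q_def apath_def)
  have "set q \<subseteq> set p"
    using awalk_to_apath_subset[OF assms(4)] by (simp add: q_def)
  then have u': "u \<notin> set (awalk_verts w q)"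
    using u set_awalk_verts[OF q(1)] set_awalk_verts[OF assms(4)] by auto
  have closing: "awalk w' [(w', u)] u"
    using assms(2) nbrs_sym[OF assms(2)] nbrs_subset
    by (auto simp: awalk_simps nbrs_def)
  have loop: "awalk w (q @ [(w', u)]) u"
    using q(1) closing by (rule awalk_appendI)
  have "awalk u ((u, w) # q @ [(w', u)]) u"
    using assms(1) loop in_arcsD1 by (auto simp: awalk_Cons_iff nbrs_def)
  moreover have "awalk_verts w (q @ [(w', u)]) = awalk_verts w q @ [u]"
    using awalk_verts_append[OF loop] q(1) by simp
  ultimately have "cycle ((u, w) # q @ [(w', u)])"
    using q(2) u' unfolding cycle_def by (intro exI[of _ u]) simp
  then have "q = []" using no_long_cycle by fastforce
  then show False using q(1) assms(3) by (simp add: awalk_Nil_iff)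
qed

text \<open>The closer neighbour is the first step of a geodesic. A second neighbour that is not
  farther away would give a walk between two neighbours of \<open>u\<close> avoiding
  \<open>u\<close>: a geodesic to \<open>v\<close>, followed by another one reversed.\<close>

lemma unique_closer_nbr:
  assumes "u \<in> pverts G" "v \<in> pverts G" "u \<noteq> v"
  obtains w where "w \<in> nbrs u" "Suc (hops w v) = hops u v"
    "\<And>w'. w' \<in> nbrs u \<Longrightarrow> w' \<noteq> w \<Longrightarrow> hops w' v = Suc (hops u v)"
proof -
  obtain p where p: "awalk u p v" "length p = hops u v"
    using geodesic[OF assms(1,2)] .
  with assms obtain e es where pe: "p = e # es"
    by (cases p) (auto simp: awalk_Nil_iff)
  define w where "w = snd e"
  have e: "e = (u, w)" and w: "w \<in> nbrs u" and es: "awalk w es v"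
    using p(1) by (cases e; auto simp: pe w_def awalk_Cons_iff nbrs_def)+
  have hw: "Suc (hops w v) = hops u v"
    using hops_le[OF es] hops_step[OF w assms(2)] p(2) by (simp add: pe)
  have other: "hops w' v = Suc (hops u v)" if w': "w' \<in> nbrs u" "w' \<noteq> w" for w'
  proof (rule ccontr)
    assume "hops w' v \<noteq> Suc (hops u v)"
    with hops_step[OF nbrs_sym[OF w'(1)] assms(2)] have le: "hops w' v \<le> hops u v"
      by simp
    obtain q where q: "awalk w' q v" "length q = hops w' v"
      using geodesic[of w' v] nbrs_subset w'(1) assms(2) by blast
    \<comment> \<open>Past its start, the geodesic from \<open>w'\<close> only meets vertices closer
      to \<open>v\<close> than \<open>w'\<close>, hence closer than \<open>u\<close>.\<close>
    have uq: "u \<notin> set (awalk_verts w' q)"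
      using geodesic_verts[OF q] le nbrs_neq[OF w'(1)] by fastforce
    have "length es = hops w v" using p(2) hw by (simp add: pe)
    then have ues: "u \<notin> set (awalk_verts w es)"
      using geodesic_verts[OF es] hw nbrs_neq[OF w] by fastforce
    have rev: "awalk v (rev_path q) w'" using q(1) by simp
    have "set (awalk_verts w (es @ rev_path q)) = set (awalk_verts w es) \<union> set (awalk_verts w' q)"
      using set_awalk_verts_append[OF es rev] awalk_verts_rev_path[OF q(1)] by simp
    moreover have "u \<in> set (awalk_verts w (es @ rev_path q))"
      by (rule awalk_between_nbrs_visits[OF w w'(1)])
        (use w'(2) awalk_appendI[OF es rev] in auto)
    ultimately show False using uq ues by simp
  qed
  show ?thesis using that[OF w hw other] .
qed

end

lemma undirected_tree_imp_bidirected_tree: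
  assumes "undirected_tree G"
  shows "bidirected_tree G"
proof -
  interpret pair_bidirected_digraph G
    using assms by (simp add: undirected_tree_def)
  show ?thesis
    using assms by unfold_locales (auto simp: undirected_tree_def not_le)
qed

section \<open>Radial functions on regular trees\<close>

locale regular_bidirected_tree = bidirected_tree G for G :: "'a pair_pre_digraph" +
  fixes d :: nat
  assumes finite_nbrs: "u \<in> pverts G \<Longrightarrow> finite (nbrs u)"
    and card_nbrs: "u \<in> pverts G \<Longrightarrow> card (nbrs u) = d"

lemma regular_tree_imp_regular_bidirected_tree:
  assumes "regular_tree d G"
  shows "regular_bidirected_tree G d"
proof -
  interpret bidirected_tree G
    using assms by (intro undirected_tree_imp_bidirected_tree) (simp add: regular_tree_def)
  have out: "out_arcs (with_proj G) u = Pair u ` nbrs u" for u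
    by (auto simp: nbrs_def)
  have inj: "inj_on (Pair u) (nbrs u)" for u
    by (simp add: inj_on_def)
  show ?thesis
    using assms
    by unfold_locales
      (auto simp: regular_tree_def out_degree_def out card_image[OF inj] finite_image_iff[OF inj])
qed

text \<open>For \<open>q = 1 - 1/d\<close> this is the adjacency operator divided by
  \<open>sqrt d\<close>, acting on the coefficients \<open>g\<close> of the radial function with
  value \<open>g j / sqrt d ^ j\<close> at distance \<open>j\<close>. All \<open>d\<close>
  neighbours of the root are farther out, so the first equation has no factor
  \<open>q\<close>.\<close>

fun radial_step :: "real \<Rightarrow> (nat \<Rightarrow> real) \<Rightarrow> nat \<Rightarrow> real" where
  "radial_step q g 0 = g 1"
| "radial_step q g (Suc j) = g j + q * g (Suc (Suc j))"

text \<open>The distance-\<open>k\<close> operator divided by \<open>sqrt d ^ k\<close>, in the same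
  coordinates. The subtracted term counts returns to the smaller sphere: \<open>d - 1\<close> of
  them become \<open>q\<close>, and the \<open>d\<close> returns to the centre when
  \<open>k = 0\<close> become 1.\<close>

fun radial_op :: "real \<Rightarrow> nat \<Rightarrow> (nat \<Rightarrow> real) \<Rightarrow> nat \<Rightarrow> real" where
  "radial_op q 0 g = g"
| "radial_op q (Suc 0) g = radial_step q g"
| "radial_op q (Suc (Suc k)) g =
     (\<lambda>j. radial_step q (radial_op q (Suc k) g) j - (if k = 0 then 1 else q) * radial_op q k g j)"

context regular_bidirected_tree
begin

definition sphere :: "nat \<Rightarrow> 'a \<Rightarrow> 'a set" where
  "sphere k u = {x \<in> pverts G. hops u x = k}"

lemma sphere_0: "u \<in> pverts G \<Longrightarrow> sphere 0 u = {u}"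
  by (auto simp: sphere_def hops_eq_0_iff)

lemma hops_nbr:
  assumes "u \<in> pverts G" "v \<in> pverts G" "w \<in> nbrs u"
  shows "hops u v = Suc (hops w v) \<or> hops w v = Suc (hops u v)"
proof (cases "u = v")
  case True
  have "hops w v \<noteq> 0"
    using hops_eq_0_iff[of w v] nbrs_neq[OF assms(3)] nbrs_subset assms True by blast
  moreover have "hops w v \<le> Suc (hops u v)"
    using hops_step[OF nbrs_sym[OF assms(3)] assms(2)] .
  ultimately show ?thesis using hops_eq_0_iff[of u v] assms True by simp
next
  case False
  then show ?thesis
    using unique_closer_nbr[OF assms(1,2)] assms(3) by metis
qed

lemma sphere_1:
  assumes "u \<in> pverts G"
  shows "sphere (Suc 0) u = nbrs u"
proof (intro set_eqI iffI)
  fix x assume "x \<in> sphere (Suc 0) u"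
  then have x: "x \<in> pverts G" "hops u x = 1" by (auto simp: sphere_def)
  then have "u \<noteq> x" using hops_eq_0_iff[of u x] assms by auto
  then obtain w where "w \<in> nbrs u" "Suc (hops w x) = hops u x"
    using unique_closer_nbr[OF assms x(1)] by metis
  then show "x \<in> nbrs u"
    using x hops_eq_0_iff[of w x] nbrs_subset by auto
next
  fix x assume x: "x \<in> nbrs u"
  then have "x \<in> pverts G" using nbrs_subset by auto
  then show "x \<in> sphere (Suc 0) u"
    using hops_nbr[OF assms _ x, of x] hops_eq_0_iff[of x x] by (auto simp: sphere_def)
qed

lemma finite_sphere: "u \<in> pverts G \<Longrightarrow> finite (sphere k u)"
proof (induct k arbitrary: u)
  case 0
  then show ?case by (simp add: sphere_0)
next
  case (Suc k)
  have "sphere (Suc k) u \<subseteq> (\<Union>w\<in>nbrs u. sphere k w)"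
  proof
    fix x assume "x \<in> sphere (Suc k) u"
    then have x: "x \<in> pverts G" "hops u x = Suc k" by (auto simp: sphere_def)
    then have "u \<noteq> x" using hops_eq_0_iff[of u x] Suc.prems by auto
    then obtain w where "w \<in> nbrs u" "Suc (hops w x) = hops u x"
      using unique_closer_nbr[OF Suc.prems x(1)] by metis
    then show "x \<in> (\<Union>w\<in>nbrs u. sphere k w)"
      using x by (auto simp: sphere_def)
  qed
  moreover have "finite (\<Union>w\<in>nbrs u. sphere k w)"
    using Suc nbrs_subset finite_nbrs by blast
  ultimately show ?case by (rule finite_subset)
qed

text \<open>One neighbour is closer to \<open>v\<close> and the others are farther, except at
  \<open>v\<close> itself. This is used with the root as \<open>v\<close> for radial functions, and
  with an indicator as \<phi> for counting neighbours.\<close>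

lemma sum_nbrs_radial:
  fixes \<phi> :: "nat \<Rightarrow> real"
  assumes "u \<in> pverts G" "v \<in> pverts G"
  shows "(\<Sum>w\<in>nbrs u. \<phi> (hops w v)) =
    (if u = v then real d * \<phi> 1
     else \<phi> (hops u v - 1) + (real d - 1) * \<phi> (Suc (hops u v)))"
proof (cases "u = v")
  case True
  have "hops w v = 1" if "w \<in> nbrs u" for w
    using hops_nbr[OF assms that] hops_eq_0_iff[of u v] assms True by auto
  then show ?thesis using True card_nbrs[OF assms(1)] by simp
next
  case False
  obtain w where w: "w \<in> nbrs u" "Suc (hops w v) = hops u v"
    and other: "\<And>w'. w' \<in> nbrs u \<Longrightarrow> w' \<noteq> w \<Longrightarrow> hops w' v = Suc (hops u v)"
    using unique_closer_nbr[OF assms False] by metis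
  have fin: "finite (nbrs u)" using finite_nbrs assms by blast
  have "card (nbrs u) > 0" using fin w(1) by (auto simp: card_gt_0_iff)
  then have "real (card (nbrs u - {w})) = real d - 1"
    using w(1) fin card_nbrs[OF assms(1)] by (simp add: card_Diff_singleton of_nat_diff)
  moreover have "(\<Sum>w'\<in>nbrs u - {w}. \<phi> (hops w' v)) = (\<Sum>w'\<in>nbrs u - {w}. \<phi> (Suc (hops u v)))"
    by (rule sum.cong) (auto simp: other)
  moreover have "hops w v = hops u v - 1" using w(2) by simp
  ultimately show ?thesis
    using False sum.remove[OF fin w(1), of "\<lambda>w. \<phi> (hops w v)"] by simp
qed

text \<open>The operator recursion applied to \<open>f\<close>, by double counting: each
  \<open>x\<close> occurs once for every neighbour of \<open>u\<close> at distance
  \<open>Suc k\<close> from it.\<close>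

lemma sum_nbrs_sphere:
  fixes f :: "'a \<Rightarrow> real"
  assumes u: "u \<in> pverts G"
  shows "(\<Sum>w\<in>nbrs u. \<Sum>x\<in>sphere (Suc k) w. f x) =
    (\<Sum>x\<in>sphere (Suc (Suc k)) u. f x) +
    (if k = 0 then real d else real d - 1) * (\<Sum>x\<in>sphere k u. f x)"
proof -
  \<comment> \<open>Moving from \<open>w\<close> to \<open>u\<close> changes each distance by
    exactly one, so \<open>X\<close> contains all points of the inner spheres.\<close>
  define X where "X = sphere (Suc (Suc k)) u \<union> sphere k u"
  have fin: "finite X" using finite_sphere[OF u] by (simp add: X_def)
  \<comment> \<open>A point at distance \<open>k + 2\<close> is seen only from the closer neighbour,
    a point at distance \<open>k\<close> from all farther ones.\<close>
  have count: "(\<Sum>w\<in>nbrs u. of_bool (hops w x = Suc k)) =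
      (if hops u x = k then if k = 0 then real d else real d - 1 else 1)" if "x \<in> X" for x
    using that sum_nbrs_radial[OF u, of x "\<lambda>n. of_bool (n = Suc k)"] hops_eq_0_iff[OF u, of x]
    by (auto simp: X_def sphere_def split: if_splits)
  have "(\<Sum>x\<in>sphere (Suc k) w. f x) = (\<Sum>x\<in>X. f x * of_bool (hops w x = Suc k))"
    if w: "w \<in> nbrs u" for w
  proof -
    have "sphere (Suc k) w = X \<inter> {x. hops w x = Suc k}"
      using hops_nbr[OF u _ w] by (fastforce simp: X_def sphere_def)
    then show ?thesis using fin by (simp add: of_bool_def sum.inter_restrict if_distrib cong: if_cong)
  qed
  then have "(\<Sum>w\<in>nbrs u. \<Sum>x\<in>sphere (Suc k) w. f x) =
      (\<Sum>w\<in>nbrs u. \<Sum>x\<in>X. f x * of_bool (hops w x = Suc k))"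
    by simp
  also have "\<dots> = (\<Sum>x\<in>X. f x * (\<Sum>w\<in>nbrs u. of_bool (hops w x = Suc k)))"
    by (subst sum.swap) (simp add: sum_distrib_left)
  also have "\<dots> = (\<Sum>x\<in>X. f x * (if hops u x = k then if k = 0 then real d else real d - 1 else 1))"
    by (rule sum.cong) (simp_all add: count)
  also have "\<dots> = (\<Sum>x\<in>sphere (Suc (Suc k)) u. f x * 1) +
      (\<Sum>x\<in>sphere k u. f x * (if k = 0 then real d else real d - 1))"
  proof -
    have "sphere (Suc (Suc k)) u \<inter> sphere k u = {}"
      by (auto simp: sphere_def)
    then show ?thesis
      unfolding X_def using finite_sphere[OF u]
      by (subst sum.union_disjoint)
        (auto simp: sphere_def intro!: arg_cong2[of _ _ _ _ "(+)"] sum.cong)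
  qed
  finally show ?thesis by (simp add: sum_distrib_left mult.commute)
qed

text \<open>The weights \<open>(sqrt d) ^ -hops x r\<close> normalise the radial functions so that the
  coefficients of the recursion converge as \<open>d\<close> grows.\<close>

lemma sum_sphere_radial:
  fixes g :: "nat \<Rightarrow> real"
  assumes "d > 0" "r \<in> pverts G" "u \<in> pverts G"
  shows "(\<Sum>x\<in>sphere k u. g (hops x r) / sqrt d ^ hops x r) =
    sqrt d ^ k * (radial_op (1 - 1 / d) k g (hops u r) / sqrt d ^ hops u r)"
proof -
  define a where "a = sqrt d"
  define q where "q = 1 - 1 / real d"
  have a: "a > 0" and ad: "real d = a * a" using assms(1) by (auto simp: a_def)
  have qa: "q = 1 - 1 / (a * a)" by (simp add: q_def ad)
  \<comment> \<open>The case \<open>k = 1\<close>, for arbitrary \<open>h\<close> because the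
    induction applies it to \<open>radial_op q (Suc k) g\<close>.\<close>
  have step: "(\<Sum>w\<in>nbrs u. h (hops w r) / a ^ hops w r) =
      a * (radial_step q h (hops u r) / a ^ hops u r)"
    if u: "u \<in> pverts G" for h :: "nat \<Rightarrow> real" and u
  proof (cases "hops u r")
    case 0
    then have "u = r" using hops_eq_0_iff[OF u assms(2)] by simp
    with 0 show ?thesis
      using sum_nbrs_radial[OF u assms(2), of "\<lambda>n. h n / a ^ n"] a by (simp add: ad)
  next
    case (Suc j)
    then have "u \<noteq> r" using hops_eq_0_iff[OF u assms(2)] by auto
    with Suc have "(\<Sum>w\<in>nbrs u. h (hops w r) / a ^ hops w r) =
        h j / a ^ j + (a * a - 1) * (h (Suc (Suc j)) / a ^ Suc (Suc j))"
      using sum_nbrs_radial[OF u assms(2), of "\<lambda>n. h n / a ^ n"] by (simp add: ad)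
    also have "\<dots> = a * (radial_step q h (hops u r) / a ^ hops u r)"
      using a by (simp add: Suc qa field_simps)
    finally show ?thesis .
  qed
  have "(\<Sum>x\<in>sphere k u. g (hops x r) / a ^ hops x r) =
      a ^ k * (radial_op q k g (hops u r) / a ^ hops u r)"
    using assms(3)
  proof (induct k arbitrary: u rule: induct_nat_012)
    case 0
    then show ?case by (simp add: sphere_0)
  next
    case 1
    then show ?case using step[OF 1] by (simp add: sphere_1)
  next
    case (ge2 k)
    define c where "c = (if k = 0 then 1 else q)"
    have c: "(if k = 0 then real d else real d - 1) = a * a * c"
      using a by (simp add: c_def ad qa field_simps)
    have "(\<Sum>x\<in>sphere (Suc (Suc k)) u. g (hops x r) / a ^ hops x r) =
        (\<Sum>w\<in>nbrs u. \<Sum>x\<in>sphere (Suc k) w. g (hops x r) / a ^ hops x r)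
        - a * a * c * (\<Sum>x\<in>sphere k u. g (hops x r) / a ^ hops x r)"
      using sum_nbrs_sphere[OF ge2.prems, of "\<lambda>x. g (hops x r) / a ^ hops x r" k]
      unfolding c by simp
    also have "(\<Sum>w\<in>nbrs u. \<Sum>x\<in>sphere (Suc k) w. g (hops x r) / a ^ hops x r) =
        (\<Sum>w\<in>nbrs u. a ^ Suc k * (radial_op q (Suc k) g (hops w r) / a ^ hops w r))"
      by (rule sum.cong[OF refl]) (use ge2.hyps(2) nbrs_subset in blast)
    also have "\<dots> = a ^ Suc k * (a * (radial_step q (radial_op q (Suc k) g) (hops u r) / a ^ hops u r))"
      by (simp only: sum_distrib_left[symmetric] step[OF ge2.prems])
    also have "(\<Sum>x\<in>sphere k u. g (hops x r) / a ^ hops x r) =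
        a ^ k * (radial_op q k g (hops u r) / a ^ hops u r)"
      by (rule ge2.hyps(1)[OF ge2.prems])
    finally show ?case
      by (simp add: c_def[symmetric] algebra_simps diff_divide_distrib)
  qed
  then show ?thesis by (simp add: a_def q_def)
qed

text \<open>The whole column \<open>r\<close> is followed, since the induction needs its entries at
  all \<open>u\<close>. It starts as the root indicator and stays radial; the factor
  \<open>sqrt d ^ k\<close> of \<open>sum_sphere_radial\<close> cancels the normalisation.\<close>

lemma matrix_power_distance_graph:
  assumes "d > 0" "r \<in> pverts G" "u \<in> pverts G"
  shows "matrix_power (pverts G)
      (\<lambda>u v. real d powr (- (real k / 2)) * adjacency_matrix (distance_graph k G) u v) m u r =
    (radial_op (1 - 1 / d) k ^^ m) (\<lambda>j. of_bool (j = 0)) (hops u r) / sqrt d ^ hops u r"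
  using assms(3)
proof (induct m arbitrary: u)
  case 0
  then show ?case using hops_eq_0_iff[OF 0 assms(2)] by (cases "u = r") auto
next
  case (Suc m)
  define M where
    "M = (\<lambda>u v. real d powr (- (real k / 2)) * adjacency_matrix (distance_graph k G) u v)"
  define g where "g = (radial_op (1 - 1 / d) k ^^ m) (\<lambda>j. of_bool (j = 0))"
  have scale: "real d powr (- (real k / 2)) * sqrt d ^ k = 1"
    using assms(1) by (simp add: powr_half_sqrt[symmetric] powr_realpow[symmetric] powr_powr powr_add[symmetric])
  have M: "M u w = (if hops u w = k then real d powr (- (real k / 2)) else 0)"
    if "w \<in> pverts G" for w
    using that Suc.prems
    by (simp add: M_def adjacency_matrix_def distance_graph_def graph_dist_eq_hops)
  have "matrix_power (pverts G) M (Suc m) u r =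
      (\<Sum>\<^sub>\<infinity>w\<in>pverts G. M u w * matrix_power (pverts G) M m w r)"
    by (simp add: matrix_times_def)
  also have "\<dots> = (\<Sum>\<^sub>\<infinity>w\<in>sphere k u. real d powr (- (real k / 2)) * (g (hops w r) / sqrt d ^ hops w r))"
    by (rule infsum_cong_neutral) (auto simp: sphere_def M Suc.hyps[folded M_def] g_def)
  also have "\<dots> = real d powr (- (real k / 2)) * (\<Sum>w\<in>sphere k u. g (hops w r) / sqrt d ^ hops w r)"
    using finite_sphere[OF Suc.prems] by (simp add: sum_distrib_left)
  also have "\<dots> = radial_op (1 - 1 / d) k g (hops u r) / sqrt d ^ hops u r"
    unfolding sum_sphere_radial[OF assms(1,2) Suc.prems] mult.assoc[symmetric] scale by simp
  finally show ?case by (simp add: M_def g_def)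
qed

end

lemma vacuum_moments_distance_graph:
  assumes "regular_tree d G" "d > 0" "r \<in> pverts G"
  shows "vacuum_moments (pverts G) r
      (\<lambda>u v. real d powr (- (real k / 2)) * adjacency_matrix (distance_graph k G) u v) m =
    (radial_op (1 - 1 / d) k ^^ m) (\<lambda>j. of_bool (j = 0)) 0"
proof -
  interpret regular_bidirected_tree G d
    using assms(1) by (rule regular_tree_imp_regular_bidirected_tree)
  show ?thesis
    using matrix_power_distance_graph[OF assms(2,3,3), of k m] hops_eq_0_iff[OF assms(3,3)]
    by (simp add: vacuum_moments_def vacuum_state_def)
qed

section \<open>Limits of the radial operators\<close>

lemma tendsto_radial_step:
  assumes "q \<longlonglongrightarrow> q0" "\<And>j. (\<lambda>n. g n j) \<longlonglongrightarrow> h j"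
  shows "(\<lambda>n. radial_step (q n) (g n) j) \<longlonglongrightarrow> radial_step q0 h j"
  using assms by (cases j) (auto intro!: tendsto_intros)

text \<open>Pointwise convergence suffices, as each value depends on finitely many values of the
  argument. The argument varies with \<open>n\<close> too, so that the operator can be
  iterated.\<close>

lemma tendsto_radial_op:
  assumes q: "q \<longlonglongrightarrow> q0" and g: "\<And>j. (\<lambda>n. g n j) \<longlonglongrightarrow> h j"
  shows "(\<lambda>n. radial_op (q n) k (g n) j) \<longlonglongrightarrow> radial_op q0 k h j"
proof (induct k arbitrary: j rule: induct_nat_012)
  case 0
  then show ?case by (simp add: g)
next
  case 1
  then show ?case by (simp add: tendsto_radial_step[OF q g])
next
  case (ge2 k)
  have "(\<lambda>n. if k = 0 then 1 else q n) \<longlonglongrightarrow> (if k = 0 then 1 else q0)"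
    using q by simp
  then show ?case
    using ge2 by (auto intro!: tendsto_diff tendsto_mult tendsto_radial_step[OF q])
qed

lemma tendsto_radial_op_funpow:
  assumes "q \<longlonglongrightarrow> q0"
  shows "(\<lambda>n. (radial_op (q n) k ^^ m) g j) \<longlonglongrightarrow> (radial_op q0 k ^^ m) g j"
  by (induct m arbitrary: j) (auto intro: tendsto_radial_op[OF assms])

section \<open>Chebyshev polynomials and the semicircle law\<close>

text \<open>These are the second-kind Chebyshev polynomials at \<open>x / 2\<close>. Multiplying by
  the sine avoids dividing by its zeros.\<close>

lemma poly_chebyshev_P_cos_times_sin:
  "poly (chebyshev_P n) (2 * cos t) * sin t = sin (real (Suc n) * t)"
proof (induct n rule: induct_nat_012)
  case 0
  then show ?case by simp
next
  case 1
  then show ?case by (simp add: sin_double)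
next
  case (ge2 n)
  have "sin (real (Suc (Suc n)) * t + t) + sin (real (Suc (Suc n)) * t - t) =
      2 * cos t * sin (real (Suc (Suc n)) * t)"
    by (simp add: sin_add sin_diff)
  moreover have "real (Suc (Suc n)) * t + t = real (Suc (Suc (Suc n))) * t"
    and "real (Suc (Suc n)) * t - t = real (Suc n) * t"
    by (simp_all add: algebra_simps)
  ultimately have "sin (real (Suc (Suc (Suc n))) * t) =
      2 * cos t * sin (real (Suc (Suc n)) * t) - sin (real (Suc n) * t)"
    by simp
  also have "\<dots> = poly (chebyshev_P (Suc (Suc n))) (2 * cos t) * sin t"
    by (simp only: ge2[symmetric] chebyshev_P.simps poly_diff poly_mult left_diff_distrib) simp
  finally show ?case by simp
qed

lemma has_integral_semicircle_chebyshev_P: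
  assumes "n > 0"
  shows "((\<lambda>x. sqrt (4 - x\<^sup>2) * poly (chebyshev_P n) x) has_integral 0) {-2..2}"
proof -
  define t where "t = (\<lambda>x::real. arccos (x / 2))"
  \<comment> \<open>Substituting \<open>x = 2 * cos t\<close> turns the integrand into
    \<open>2 * sin ((n + 1) * t)\<close> and \<open>dx\<close> into \<open>- 2 * sin t dt\<close>.
    The product formula for sines then gives this antiderivative, which vanishes at
    \<open>t = 0\<close> and \<open>t = pi\<close>.\<close>
  define F where
    "F = (\<lambda>x. - 2 * (sin (real n * t x) / real n - sin (real (n + 2) * t x) / real (n + 2)))"
  have "((\<lambda>x. sqrt (4 - x\<^sup>2) * poly (chebyshev_P n) x) has_integral (F 2 - F (-2))) {-2..2}"
  \<comment> \<open>At the endpoints \<open>arccos\<close> is continuous but not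
    differentiable.\<close>
  proof (rule fundamental_theorem_of_calculus_interior)
    show "continuous_on {-2..2} F"
      unfolding F_def t_def using assms by (intro continuous_intros) auto
    fix x :: real
    assume x: "x \<in> {-2<..<2}"
    define \<sigma> where "\<sigma> = sin (t x)"
    have \<sigma>: "\<sigma> = sqrt (1 - (x / 2)\<^sup>2)" using x by (simp add: \<sigma>_def t_def sin_arccos)
    have "(x / 2)\<^sup>2 < 1" using x by (auto simp: abs_square_less_1)
    then have pos: "\<sigma> > 0" by (simp add: \<sigma>)
    have "4 - x\<^sup>2 = 2\<^sup>2 * (1 - (x / 2)\<^sup>2)" by (simp add: power_divide)
    then have root: "sqrt (4 - x\<^sup>2) = 2 * \<sigma>"
      by (simp only: real_sqrt_mult \<sigma>) simp
    have xt: "x = 2 * cos (t x)" using x by (simp add: t_def)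
    have dt: "(t has_real_derivative - 1 / (2 * \<sigma>)) (at x)"
      unfolding t_def \<sigma> using x
      by (auto intro!: derivative_eq_intros simp: divide_simps)
    have dsin: "((\<lambda>x. sin (c * t x) / c) has_real_derivative cos (c * t x) * (- 1 / (2 * \<sigma>))) (at x)"
      if "c \<noteq> 0" for c
      using that by (auto intro!: derivative_eq_intros dt)
    have "(F has_real_derivative - 2 * (cos (real n * t x) * (- 1 / (2 * \<sigma>)) -
        cos (real (n + 2) * t x) * (- 1 / (2 * \<sigma>)))) (at x)"
      unfolding F_def using assms by (intro DERIV_cmult DERIV_diff dsin) auto
    also have "- 2 * (cos (real n * t x) * (- 1 / (2 * \<sigma>)) -
          cos (real (n + 2) * t x) * (- 1 / (2 * \<sigma>))) =
        (cos (real n * t x) - cos (real (n + 2) * t x)) / \<sigma>"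
      by (simp add: diff_divide_distrib)
    also have "cos (real n * t x) - cos (real (n + 2) * t x) =
        cos (real (Suc n) * t x - t x) - cos (real (Suc n) * t x + t x)"
      by (simp add: algebra_simps)
    also have "\<dots> = 2 * sin (real (Suc n) * t x) * \<sigma>"
      unfolding cos_add cos_diff \<sigma>_def by simp
    also have "2 * sin (real (Suc n) * t x) * \<sigma> / \<sigma> = 2 * sin (real (Suc n) * t x)"
      using pos by simp
    also have "\<dots> = sqrt (4 - x\<^sup>2) * poly (chebyshev_P n) x"
      unfolding root poly_chebyshev_P_cos_times_sin[symmetric] by (simp add: \<sigma>_def xt[symmetric])
    finally show "(F has_vector_derivative sqrt (4 - x\<^sup>2) * poly (chebyshev_P n) x) (at x)"
      by (simp add: has_real_derivative_iff_has_vector_derivative)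
  qed simp
  moreover have "F 2 = 0" "F (-2) = 0"
    using sin_npi[of n] sin_npi[of "n + 2"] by (simp_all add: F_def t_def)
  ultimately show ?thesis by simp
qed

section \<open>Expectations of polynomials in a semicircular variable\<close>

locale semicircular = prob_space \<Omega> for \<Omega> :: "'b measure" +
  fixes s :: "'b \<Rightarrow> real"
  assumes semicircle_distributed: "distributed \<Omega> lborel s (\<lambda>x. ennreal (semicircle_density x))"
begin

lemma measurable_s [measurable]: "s \<in> borel_measurable \<Omega>"
  using distributed_measurable[OF semicircle_distributed] by simp

lemma measurable_poly_s [measurable]: "(\<lambda>\<omega>. poly p (s \<omega>)) \<in> borel_measurable \<Omega>"
proof -
  have "poly p \<in> borel_measurable borel"
    by (intro borel_measurable_continuous_onI continuous_intros)
  then show ?thesis by measurable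
qed

text \<open>The density vanishes outside a compact interval, so the polynomial is almost surely
  bounded.\<close>

lemma integrable_poly_s: "integrable \<Omega> (\<lambda>\<omega>. poly p (s \<omega>))"
proof -
  have "compact (poly p ` {-2..2::real})"
    by (intro compact_continuous_image continuous_intros) auto
  then obtain B where B: "\<And>x. x \<in> {-2..2} \<Longrightarrow> norm (poly p x) \<le> B"
    using compact_imp_bounded[of "poly p ` {-2..2}"] unfolding bounded_iff by blast
  have "AE x in lborel. 0 < ennreal (semicircle_density x) \<longrightarrow> x \<in> {-2..2}"
    by (auto simp: semicircle_density_def)
  then have "AE \<omega> in \<Omega>. s \<omega> \<in> {-2..2}"
    by (subst distributed_AE2[OF semicircle_distributed]) auto
  then have "AE \<omega> in \<Omega>. norm (poly p (s \<omega>)) \<le> B"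
    by eventually_elim (rule B)
  then show ?thesis
    by (rule integrable_const_bound) simp
qed

lemma expectation_chebyshev_P:
  "expectation (\<lambda>\<omega>. poly (chebyshev_P n) (s \<omega>)) = of_bool (n = 0)"
proof (cases "n = 0")
  \<comment> \<open>Here the value is the total mass of the probability space.\<close>
  case True
  then show ?thesis by (simp add: prob_space)
next
  case False
  define f where "f = (\<lambda>x. sqrt (4 - x\<^sup>2) * poly (chebyshev_P n) x)"
  have int: "set_integrable lborel {-2..2} f"
    unfolding f_def by (intro borel_integrable_atLeastAtMost' continuous_intros)
  have "expectation (\<lambda>\<omega>. poly (chebyshev_P n) (s \<omega>)) =
      (\<integral>x. semicircle_density x * poly (chebyshev_P n) x \<partial>lborel)"
  proof (rule distributed_integral[OF semicircle_distributed, symmetric])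
    show "poly (chebyshev_P n) \<in> borel_measurable lborel"
      by (simp add: borel_measurable_continuous_onI continuous_intros)
    show "0 \<le> semicircle_density x" for x
      using abs_le_square_iff[of x 2] by (auto simp: semicircle_density_def abs_le_iff)
  qed
  also have "\<dots> = (\<integral>x. (1 / (2 * pi)) * (indicator {-2..2} x *\<^sub>R f x) \<partial>lborel)"
    by (rule Bochner_Integration.integral_cong) (auto simp: semicircle_density_def f_def indicator_def)
  also have "\<dots> = (1 / (2 * pi)) * integral {-2..2} f"
    using set_borel_integral_eq_integral(2)[OF int] by (simp add: set_lebesgue_integral_def)
  also have "integral {-2..2} f = 0"
    unfolding f_def by (rule integral_unique[OF has_integral_semicircle_chebyshev_P]) (use False in simp)
  finally show ?thesis using False by simp
qed

end

section \<open>The limiting operators as multiplication by Chebyshev polynomials\<close>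

context semicircular
begin

text \<open>Since \<open>x * P_j = P_(j-1) + P_(j+1)\<close>, \<open>radial_step 1\<close>
  multiplies \<open>p\<close> by \<open>x\<close>. At \<open>q = 1\<close> the exceptional
  coefficient agrees with the others, so \<open>radial_op\<close> obeys the recursion of
  \<open>chebyshev_P\<close>.\<close>

lemma radial_op_expectation:
  "radial_op 1 k (\<lambda>j. expectation (\<lambda>\<omega>. poly (p * chebyshev_P j) (s \<omega>))) =
    (\<lambda>j. expectation (\<lambda>\<omega>. poly (p * chebyshev_P k * chebyshev_P j) (s \<omega>)))"
proof -
  define L where "L = (\<lambda>p. expectation (\<lambda>\<omega>. poly p (s \<omega>)))"
  have add: "L (p + q) = L p + L q" and diff: "L (p - q) = L p - L q" for p q
    unfolding L_def by (simp_all add: integrable_poly_s)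
  have step: "radial_step 1 (\<lambda>j. L (p * chebyshev_P j)) j = L (p * [:0, 1:] * chebyshev_P j)" for p j
  proof (cases j)
    case (Suc i)
    have "p * [:0, 1:] * chebyshev_P (Suc i) = p * chebyshev_P i + p * chebyshev_P (Suc (Suc i))"
      by (simp only: chebyshev_P.simps algebra_simps)
    then show ?thesis by (simp only: Suc radial_step.simps add mult_1_left)
  qed simp
  have "radial_op 1 k (\<lambda>j. L (p * chebyshev_P j)) = (\<lambda>j. L (p * chebyshev_P k * chebyshev_P j))"
  proof (induct k rule: induct_nat_012)
    case 0
    then show ?case by simp
  next
    case 1
    then show ?case by (simp only: radial_op.simps step chebyshev_P.simps fun_eq_iff) simp
  next
    case (ge2 k)
    have "p * chebyshev_P (Suc k) * [:0, 1:] * chebyshev_P j - p * chebyshev_P k * chebyshev_P j =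
        p * chebyshev_P (Suc (Suc k)) * chebyshev_P j" for j
      by (simp only: chebyshev_P.simps) (simp only: algebra_simps)
    then show ?case
      by (simp only: radial_op.simps ge2 step if_cancel mult_1_left diff[symmetric])
  qed
  then show ?thesis by (simp only: L_def)
qed

lemma radial_op_funpow_expectation:
  "(radial_op 1 k ^^ m) (\<lambda>j. of_bool (j = 0)) =
    (\<lambda>j. expectation (\<lambda>\<omega>. poly (chebyshev_P k ^ m * chebyshev_P j) (s \<omega>)))"
proof (induct m)
  case 0
  then show ?case by (simp add: expectation_chebyshev_P)
next
  case (Suc m)
  then show ?case
    by (simp only: funpow.simps o_apply radial_op_expectation power_Suc2)
qed

end

theorem theorem3p2:
  fixes T :: "nat \<Rightarrow> 'a pair_pre_digraph"
    and r :: "nat \<Rightarrow> 'a"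
    and k :: nat
    and \<Omega> :: "'b measure"
    and s :: "'b \<Rightarrow> real"
  assumes "\<And>d. d \<ge> 2 \<Longrightarrow> regular_tree d (T d)"
    and "\<And>d. d \<ge> 2 \<Longrightarrow> r d \<in> pverts (T d)"
    and "k \<ge> 1"
    and "prob_space \<Omega>"
    and "distributed \<Omega> lborel s (\<lambda>x. ennreal (semicircle_density x))"
  shows "converges_in_moments
           (\<lambda>d. vacuum_moments (pverts (T d)) (r d)
              (\<lambda>u v. real d powr (- (real k / 2)) * adjacency_matrix (distance_graph k (T d)) u v))
           (distr \<Omega> borel (\<lambda>\<omega>. poly (chebyshev_P k) (s \<omega>)))"
proof -
  interpret semicircular \<Omega> s
    using assms(4,5) by (simp add: semicircular_def semicircular_axioms_def)
  define c where "c = (\<lambda>d. vacuum_moments (pverts (T d)) (r d)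
    (\<lambda>u v. real d powr (- (real k / 2)) * adjacency_matrix (distance_graph k (T d)) u v))"
  define X where "X = (\<lambda>\<omega>. poly (chebyshev_P k) (s \<omega>))"
  \<comment> \<open>The factor \<open>chebyshev_P 0 = 1\<close> exhibits the moment as the entry
    \<open>j = 0\<close> of the sequence in \<open>radial_op_funpow_expectation\<close>.\<close>
  have power_X: "X \<omega> ^ m = poly (chebyshev_P k ^ m * chebyshev_P 0) (s \<omega>)" for \<omega> m
    by (simp add: X_def poly_power)
  have X: "X \<in> borel_measurable \<Omega>"
    unfolding X_def by (rule measurable_poly_s)
  have "converges_in_moments c (distr \<Omega> borel X)"
    unfolding converges_in_moments_def
  proof (intro allI conjI)
    fix m
    show "integrable (distr \<Omega> borel X) (\<lambda>x. x ^ m)"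
      by (subst integrable_distr_eq[OF X]) (simp_all only: power_X integrable_poly_s, simp)
    have "(\<lambda>d. 1 - 1 / real d) \<longlonglongrightarrow> 1 - 0"
      by (intro tendsto_intros lim_1_over_n)
    then have "(\<lambda>d. (radial_op (1 - 1 / real d) k ^^ m) (\<lambda>j. of_bool (j = 0)) 0)
        \<longlonglongrightarrow> (radial_op 1 k ^^ m) (\<lambda>j. of_bool (j = 0)) 0"
      by (intro tendsto_radial_op_funpow) simp
    also have "(radial_op 1 k ^^ m) (\<lambda>j. of_bool (j = 0)) 0 = (\<integral>x. x ^ m \<partial>distr \<Omega> borel X)"
      by (subst integral_distr[OF X]) (simp_all only: power_X radial_op_funpow_expectation, simp)
    finally show "(\<lambda>d. c d m) \<longlonglongrightarrow> (\<integral>x. x ^ m \<partial>distr \<Omega> borel X)"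
    \<comment> \<open>The trees are only constrained for \<open>d\<close> at least 2, so the moment
      formula holds eventually.\<close>
    proof (rule Lim_transform_eventually)
      show "\<forall>\<^sub>F d in sequentially.
          (radial_op (1 - 1 / real d) k ^^ m) (\<lambda>j. of_bool (j = 0)) 0 = c d m"
        using eventually_ge_at_top[of 2]
        by eventually_elim (simp add: c_def vacuum_moments_distance_graph assms(1,2))
    qed
  qed
  then show ?thesis by (simp add: c_def X_def)
qed

end
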